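(* Let $p \ge 5$ and $p+3 \le q \le 3 + \binom{p}{\lfloor \frac{p}{2} \rfloor}$. Then $f(K(3,p,q)) = 2$.
   Context: $K(3,p,q)$ is the complete tripartite graph with parts of sizes $3$, $p$, $q$. A strong orientation of a graph is an orientation of all edges making the digraph strongly connected; the diameter of a strongly connected digraph is the maximum directed distance between ordered pairs of vertices. The oriented diameter $f(G)$ is the minimum diameter over all strong orientations of $G$. *)

theory Defs
  imports "Graph_Theory.Graph_Theory"
begin

text \<open>
  Following the library, an undirected simple graph is a digraph without loops and parallel arcs
  whose arc relation is symmetric (locale \<^locale>\<open>pair_graph\<close>): the edge between \<open>u\<close> and \<open>v\<close> is
  represented by the two arcs \<open>(u, v)\<close> and \<open>(v, u)\<close>.
\<close>

text \<open>The vertex \<open>(i, j)\<close> is the \<open>j\<close>-th vertex of the \<open>i\<close>-th part.\<close>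

definition complete_tripartite :: "nat \<Rightarrow> nat \<Rightarrow> nat \<Rightarrow> (nat \<times> nat) pair_pre_digraph" where
  "complete_tripartite a b c =
     (let V = {0} \<times> {..<a} \<union> {1} \<times> {..<b} \<union> {2} \<times> {..<c}
      in \<lparr> pverts = V, parcs = {(u, v). u \<in> V \<and> v \<in> V \<and> fst u \<noteq> fst v} \<rparr>)"

text \<open>The disequality of truth values says that exactly one of the two directions is chosen.\<close>

definition is_orientation :: "'a pair_pre_digraph \<Rightarrow> 'a pair_pre_digraph \<Rightarrow> bool" where
  "is_orientation D G \<longleftrightarrow>
     pverts D = pverts G \<and> parcs D \<subseteq> parcs G \<and>
     (\<forall>u v. (u, v) \<in> parcs G \<longrightarrow> ((u, v) \<in> parcs D) \<noteq> ((v, u) \<in> parcs D))"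

definition strong_orientations :: "'a pair_pre_digraph \<Rightarrow> 'a pair_pre_digraph set" where
  "strong_orientations G = {D. is_orientation D G \<and> strongly_connected (with_proj D)}"

text \<open>With unit weights, the cost of an arc walk is its length, so \<^const>\<open>wf_digraph.\<mu>\<close> is the
  directed distance.\<close>

definition directed_dist :: "'a pair_pre_digraph \<Rightarrow> 'a \<Rightarrow> 'a \<Rightarrow> ereal" where
  "directed_dist D u v = wf_digraph.\<mu> (with_proj D) (\<lambda>_. 1) u v"

definition diameter :: "'a pair_pre_digraph \<Rightarrow> ereal" where
  "diameter D = (SUP (u, v) \<in> pverts D \<times> pverts D. directed_dist D u v)"

text \<open>A finite graph has only finitely many orientations, so the infimum is a minimum as soon as
  there is a strong orientation (see \<open>oriented_diameter_attained\<close>); otherwise it is \<open>\<infinity>\<close>.\<close>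

definition oriented_diameter :: "'a pair_pre_digraph \<Rightarrow> ereal" where
  "oriented_diameter G = (INF D \<in> strong_orientations G. diameter D)"

lemma pair_graph_complete_tripartite: "pair_graph (complete_tripartite a b c)"
proof -
  have "finite (parcs (complete_tripartite a b c))"
    by (rule finite_subset[of _ "pverts (complete_tripartite a b c) \<times> pverts (complete_tripartite a b c)"])
       (auto simp: complete_tripartite_def Let_def)
  then show ?thesis
    by unfold_locales (auto simp: complete_tripartite_def Let_def symmetric_def sym_def)
qed

lemma finite_strong_orientations:
  assumes "pair_graph G"
  shows "finite (strong_orientations G)"
proof -
  interpret pair_graph G by fact
  have "D \<in> (\<lambda>A. \<lparr> pverts = pverts G, parcs = A \<rparr>) ` Pow (parcs G)"
    if "D \<in> strong_orientations G" for D
    using that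
    by (intro image_eqI[of _ _ "parcs D"]) (auto simp: strong_orientations_def is_orientation_def)
  then have "strong_orientations G \<subseteq> (\<lambda>A. \<lparr> pverts = pverts G, parcs = A \<rparr>) ` Pow (parcs G)"
    by blast
  then show ?thesis
    using finite_subset pair_finite_arcs by blast
qed

lemma oriented_diameter_attained:
  assumes "pair_graph G" "strong_orientations G \<noteq> {}"
  shows "\<exists>D \<in> strong_orientations G. oriented_diameter G = diameter D"
proof -
  have fin: "finite (diameter ` strong_orientations G)" and "diameter ` strong_orientations G \<noteq> {}"
    using finite_strong_orientations assms by auto
  then have "Inf (diameter ` strong_orientations G) \<in> diameter ` strong_orientations G"
    by (metis Min_in Min_Inf)
  then show ?thesis
    by (auto simp: oriented_diameter_def)
qed

lemma directed_dist_eq: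
  assumes "pair_wf_digraph D"
  shows "directed_dist D u v =
    (INF p \<in> {p. pre_digraph.awalk (with_proj D) u p v}. ereal (real (length p)))"
proof -
  interpret pair_wf_digraph D by fact
  have "awalk_cost (\<lambda>_. 1) p = real (length p)" for p
    by (induction p) auto
  then show ?thesis
    by (simp add: directed_dist_def \<mu>_def)
qed

end

theory Submission
  imports Defs
begin

text \<open>
  Write \<open>x\<^sub>i\<close>, \<open>y\<^sub>j\<close>, \<open>z\<^sub>l\<close> for the vertices of the three parts. Orient \<open>x\<^sub>0\<close> towards all \<open>y\<close>'s, \<open>x\<^sub>1\<close> only
  towards \<open>y\<^sub>0\<close>, and \<open>x\<^sub>2\<close> only towards \<open>y\<^sub>1\<close>. All but three of the \<open>z\<close>'s have an out-neighbourhood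
  \<open>{x\<^sub>0} \<union> S\<close>, where \<open>S\<close> runs through a family of \<open>\<lfloor>p/2\<rfloor>\<close>-sets of \<open>y\<close>'s that separates every
  ordered pair of \<open>y\<close>'s; the remaining three have out-neighbourhoods \<open>{x\<^sub>0, x\<^sub>1, y\<^sub>2}\<close>,
  \<open>{x\<^sub>0, x\<^sub>2, y\<^sub>2}\<close> and \<open>{x\<^sub>0, x\<^sub>1, x\<^sub>2}\<close>. These out-neighbourhoods form an antichain, which joins the
  \<open>z\<close>'s by paths of length two, and the other pairs are easy. The cyclic intervals show that \<open>p\<close>
  sets suffice to separate, and there are \<open>p choose \<lfloor>p/2\<rfloor>\<close> sets in total, which gives the range of \<open>q\<close>.
  Distance one in both directions is impossible across an edge, so two is optimal.
\<close>

section \<open>Bounding the oriented diameter by two from both sides\<close>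

lemma directed_dist_ge_2:
  assumes "pair_wf_digraph D" "u \<noteq> v" "(u, v) \<notin> parcs D"
  shows "directed_dist D u v \<ge> 2"
proof -
  have "2 \<le> length w" if "pre_digraph.awalk (with_proj D) u w v" for w
  proof (rule ccontr)
    assume "\<not> 2 \<le> length w"
    then consider "w = []" | e where "w = [e]"
      by (metis One_nat_def Suc_1 Suc_le_eq length_0_conv length_Suc_conv less_Suc_eq not_less_eq
          not_less_zero linorder_not_less)
    then show False
      using that assms(2,3) by cases (auto simp: pre_digraph.awalk_def cas_with_proj_eq)
  qed
  then show ?thesis
    unfolding directed_dist_eq[OF assms(1)] by (intro INF_greatest) force
qed

lemma directed_dist_le_awalk:
  assumes "pair_wf_digraph D" "pre_digraph.awalk (with_proj D) u w v" "length w \<le> n"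
  shows "directed_dist D u v \<le> ereal (real n)"
  unfolding directed_dist_eq[OF assms(1)] using assms(2,3) by (intro INF_lower2[of w]) auto

lemma pair_wf_digraph_orientation:
  assumes "pair_graph G" "is_orientation D G"
  shows "pair_wf_digraph D"
proof -
  interpret pair_graph G by fact
  have "pverts D = pverts G" "parcs D \<subseteq> parcs G"
    using assms(2) by (simp_all add: is_orientation_def)
  then show ?thesis
    using arc_fst_in_verts arc_snd_in_verts by unfold_locales blast+
qed

lemma oriented_diameter_ge_2:
  assumes "pair_graph G" "(u, v) \<in> parcs G"
  shows "oriented_diameter G \<ge> 2"
  unfolding oriented_diameter_def
proof (rule INF_greatest)
  fix D assume "D \<in> strong_orientations G"
  then have D: "is_orientation D G"
    by (simp add: strong_orientations_def)
  interpret G: pair_graph G by fact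
  have uv: "u \<in> pverts D" "v \<in> pverts D" "u \<noteq> v"
    using D assms(2) G.in_arcsD1 G.in_arcsD2 G.no_loops by (fastforce simp: is_orientation_def)+
  have "(u, v) \<notin> parcs D \<or> (v, u) \<notin> parcs D"
    using D assms(2) by (auto simp: is_orientation_def)
  then obtain s t where st: "s \<in> pverts D" "t \<in> pverts D" "s \<noteq> t" "(s, t) \<notin> parcs D"
    using uv by blast
  have "2 \<le> directed_dist D s t"
    by (rule directed_dist_ge_2[OF pair_wf_digraph_orientation[OF assms(1) D] st(3,4)])
  also have "\<dots> \<le> diameter D"
    unfolding diameter_def using st by (intro SUP_upper2[of "(s, t)"]) auto
  finally show "2 \<le> diameter D" .
qed

text \<open>Strong connectivity of \<open>D\<close> follows from the same walks of length at most
  two that bound its diameter.\<close>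

lemma oriented_diameter_le_2:
  assumes G: "pair_graph G" and ne: "pverts G \<noteq> {}" and D: "is_orientation D G"
    and two_step: "\<And>u v. u \<in> pverts G \<Longrightarrow> v \<in> pverts G \<Longrightarrow> u \<noteq> v \<Longrightarrow>
      (u, v) \<in> parcs D \<or> (\<exists>w. (u, w) \<in> parcs D \<and> (w, v) \<in> parcs D)"
  shows "oriented_diameter G \<le> 2"
proof -
  interpret D: pair_wf_digraph D
    by (rule pair_wf_digraph_orientation[OF G D])
  have verts: "pverts D = pverts G"
    using D by (simp add: is_orientation_def)
  have short: "\<exists>w. D.awalk u w v \<and> length w \<le> 2" if "u \<in> pverts G" "v \<in> pverts G" for u v
  proof (cases "u = v")
    case True
    then show ?thesis
      using that verts by (intro exI[of _ "[]"]) (simp add: D.awalk_def)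
  next
    case False
    from two_step[OF that False] show ?thesis
    proof (elim disjE exE conjE)
      assume "(u, v) \<in> parcs D"
      then show ?thesis
        using that verts by (intro exI[of _ "[(u, v)]"]) (simp add: D.awalk_def)
    next
      fix w assume "(u, w) \<in> parcs D" "(w, v) \<in> parcs D"
      then show ?thesis
        using that verts by (intro exI[of _ "[(u, w), (w, v)]"]) (simp add: D.awalk_def)
    qed
  qed
  have "strongly_connected (with_proj D)"
    using short ne verts by (intro strongly_connectedI) (auto simp: D.reachable_awalk)
  then have "D \<in> strong_orientations G"
    using D by (simp add: strong_orientations_def)
  moreover have "diameter D \<le> 2"
    unfolding diameter_def
  proof (rule SUP_least, clarify)
    fix u v assume "u \<in> pverts D" "v \<in> pverts D"
    then obtain w where "D.awalk u w v" "length w \<le> 2"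
      using short verts by blast
    then show "directed_dist D u v \<le> 2"
      using directed_dist_le_awalk[OF D.pair_wf_digraph_axioms, of u w v 2] by simp
  qed
  ultimately show ?thesis
    unfolding oriented_diameter_def by (rule INF_lower2)
qed

section \<open>Cyclic intervals and separating families of sets of equal size\<close>

text \<open>For i < p and k \<le> p these are the residues of i, ..., i + k - 1 modulo p; the last
  disjunct catches those that wrap around.\<close>

definition cyclic_interval :: "nat \<Rightarrow> nat \<Rightarrow> nat \<Rightarrow> nat set" where
  "cyclic_interval p k i = {y. y < p \<and> (i \<le> y \<and> y < i + k \<or> y + p < i + k)}"

lemma card_cyclic_interval:
  assumes "k \<le> p" "i < p"
  shows "card (cyclic_interval p k i) = k"
proof (cases "i + k \<le> p")
  case True
  then have "cyclic_interval p k i = {i..<i + k}"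
    by (auto simp: cyclic_interval_def)
  then show ?thesis by simp
next
  case False
  then have "cyclic_interval p k i = {i..<p} \<union> {..<i + k - p}"
    using assms by (auto simp: cyclic_interval_def)
  moreover have "{i..<p} \<inter> {..<i + k - p} = {}"
    using assms by auto
  ultimately show ?thesis
    using False assms by (simp add: card_Un_disjoint)
qed

text \<open>One of the two cyclic intervals with \<open>y\<close> as an end point works, because they
  meet only in \<open>y\<close>.\<close>
lemma cyclic_interval_separates:
  assumes "1 \<le> k" "2 * k \<le> p" "y < p" "y' < p" "y \<noteq> y'"
  shows "\<exists>i<p. y \<in> cyclic_interval p k i \<and> y' \<notin> cyclic_interval p k i"
proof (cases "y' \<in> cyclic_interval p k y")
  case False
  then show ?thesis
    using assms by (intro exI[of _ y]) (auto simp: cyclic_interval_def)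
next
  case True
  then show ?thesis
    using assms
    \<comment> \<open>The start of the interval that ends at \<open>y\<close>, shifted by
      \<open>p\<close> if it would be negative.\<close>
    by (intro exI[of _ "if k \<le> Suc y then Suc y - k else Suc y + p - k"])
      (auto simp: cyclic_interval_def)
qed

text \<open>Separation survives adding further \<open>k\<close>-sets, so the cyclic intervals, at
  most \<open>p\<close> in number, can be padded to exactly \<open>m\<close> sets.\<close>

lemma separating_family:
  assumes "1 \<le> k" "2 * k \<le> p" "p \<le> m" "m \<le> p choose k"
  obtains f :: "nat \<Rightarrow> nat set" where "inj_on f {..<m}"
    "\<And>j. j < m \<Longrightarrow> f j \<subseteq> {..<p}" "\<And>j. j < m \<Longrightarrow> card (f j) = k"
    "\<And>y y'. y < p \<Longrightarrow> y' < p \<Longrightarrow> y \<noteq> y' \<Longrightarrow> \<exists>j<m. y \<in> f j \<and> y' \<notin> f j"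
proof -
  let ?I = "cyclic_interval p k ` {..<p}" and ?S = "{S. S \<subseteq> {..<p} \<and> card S = k}"
  have "card ?I \<le> m"
    using card_image_le[of "{..<p}" "cyclic_interval p k"] assms by simp
  moreover have "m \<le> card ?S"
    using assms n_subsets[of "{..<p}" k] by simp
  moreover have "?I \<subseteq> ?S"
    using assms card_cyclic_interval by (auto simp: cyclic_interval_def)
  moreover have "finite ?S"
    by simp
  ultimately obtain F where F: "?I \<subseteq> F" "F \<subseteq> ?S" "card F = m"
    using exists_subset_between[of ?I m ?S] by auto
  have "finite F"
    using F(2) \<open>finite ?S\<close> by (rule finite_subset)
  then obtain f where f: "bij_betw f {..<m} F"
    using ex_bij_betw_nat_finite F(3) lessThan_atLeast0 by metis
  show ?thesis
  proof (rule that[of f])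
    show "inj_on f {..<m}"
      using f by (rule bij_betw_imp_inj_on)
    have "f j \<in> ?S" if "j < m" for j
      using F(2) f that by (auto dest: bij_betwE)
    then show "f j \<subseteq> {..<p}" "card (f j) = k" if "j < m" for j
      using that by auto
    fix y y' assume "y < p" "y' < p" "y \<noteq> y'"
    then obtain i where "i < p" "y \<in> cyclic_interval p k i" "y' \<notin> cyclic_interval p k i"
      using cyclic_interval_separates assms by blast
    moreover have "cyclic_interval p k i \<in> f ` {..<m}"
      using F(1) f \<open>i < p\<close> by (auto simp: bij_betw_def)
    ultimately show "\<exists>j<m. y \<in> f j \<and> y' \<notin> f j"
      by auto
  qed
qed

section \<open>Orientations of complete tripartite graphs given by out-neighbourhoods\<close>

text \<open>\<open>X i\<close> is the set of \<open>y\<close>'s dominated by \<open>x\<^sub>i\<close>; \<open>A l\<close> and \<open>B l\<close> are the sets of \<open>x\<close>'s and of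
  \<open>y\<close>'s dominated by \<open>z\<^sub>l\<close>.\<close>
definition tripartite_orientation ::
  "nat \<Rightarrow> nat \<Rightarrow> nat \<Rightarrow> (nat \<Rightarrow> nat set) \<Rightarrow> (nat \<Rightarrow> nat set) \<Rightarrow> (nat \<Rightarrow> nat set) \<Rightarrow>
    (nat \<times> nat) pair_pre_digraph" where
  "tripartite_orientation a b c X A B =
     \<lparr> pverts = pverts (complete_tripartite a b c),
       parcs =
         {((0, i), (1, j)) | i j. i < a \<and> j < b \<and> j \<in> X i} \<union>
         {((1, j), (0, i)) | i j. i < a \<and> j < b \<and> j \<notin> X i} \<union>
         {((2, l), (0, i)) | i l. i < a \<and> l < c \<and> i \<in> A l} \<union>
         {((0, i), (2, l)) | i l. i < a \<and> l < c \<and> i \<notin> A l} \<union>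
         {((2, l), (1, j)) | j l. j < b \<and> l < c \<and> j \<in> B l} \<union>
         {((1, j), (2, l)) | j l. j < b \<and> l < c \<and> j \<notin> B l} \<rparr>"

lemma in_parcs_tripartite_orientation:
  "((0, i), (Suc 0, j)) \<in> parcs (tripartite_orientation a b c X A B) \<longleftrightarrow> i < a \<and> j < b \<and> j \<in> X i"
  "((Suc 0, j), (0, i)) \<in> parcs (tripartite_orientation a b c X A B) \<longleftrightarrow> i < a \<and> j < b \<and> j \<notin> X i"
  "((2, l), (0, i)) \<in> parcs (tripartite_orientation a b c X A B) \<longleftrightarrow> i < a \<and> l < c \<and> i \<in> A l"
  "((0, i), (2, l)) \<in> parcs (tripartite_orientation a b c X A B) \<longleftrightarrow> i < a \<and> l < c \<and> i \<notin> A l"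
  "((2, l), (Suc 0, j)) \<in> parcs (tripartite_orientation a b c X A B) \<longleftrightarrow> j < b \<and> l < c \<and> j \<in> B l"
  "((Suc 0, j), (2, l)) \<in> parcs (tripartite_orientation a b c X A B) \<longleftrightarrow> j < b \<and> l < c \<and> j \<notin> B l"
  by (auto simp: tripartite_orientation_def)

lemma complete_tripartite_vertex_cases:
  assumes "w \<in> pverts (complete_tripartite a b c)"
  shows "(\<exists>i<a. w = (0, i)) \<or> (\<exists>j<b. w = (Suc 0, j)) \<or> (\<exists>l<c. w = (2, l))"
  using assms by (auto simp: complete_tripartite_def Let_def)

lemma is_orientation_tripartite_orientation:
  "is_orientation (tripartite_orientation a b c X A B) (complete_tripartite a b c)"
  unfolding is_orientation_def
proof (intro conjI allI impI)
  let ?D = "tripartite_orientation a b c X A B" and ?G = "complete_tripartite a b c"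
  show "pverts ?D = pverts ?G"
    by (simp add: tripartite_orientation_def)
  show "parcs ?D \<subseteq> parcs ?G"
    unfolding tripartite_orientation_def complete_tripartite_def Let_def pair_pre_digraph.simps
    by (intro Un_least subsetI) auto
  fix u v assume "(u, v) \<in> parcs ?G"
  then have uv: "u \<in> pverts ?G" "v \<in> pverts ?G" "fst u \<noteq> fst v"
    by (simp_all add: complete_tripartite_def Let_def)
  show "((u, v) \<in> parcs ?D) \<noteq> ((v, u) \<in> parcs ?D)"
    using uv(1,2)[THEN complete_tripartite_vertex_cases] uv(3)
    by (elim disjE exE conjE) (simp_all add: in_parcs_tripartite_orientation)
qed

text \<open>Every pair of vertices in different parts must lie on a directed triangle, and the
  out-neighbourhoods within each part must form an antichain.\<close>
lemma oriented_diameter_tripartite_le_2: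
  assumes "0 < a"
    and XY: "\<And>i j. i < a \<Longrightarrow> j < b \<Longrightarrow> j \<in> X i \<Longrightarrow> \<exists>l<c. j \<notin> B l \<and> i \<in> A l"
    and YX: "\<And>i j. i < a \<Longrightarrow> j < b \<Longrightarrow> j \<notin> X i \<Longrightarrow> \<exists>l<c. i \<notin> A l \<and> j \<in> B l"
    and ZX: "\<And>i l. i < a \<Longrightarrow> l < c \<Longrightarrow> i \<in> A l \<Longrightarrow> \<exists>j<b. j \<in> X i \<and> j \<notin> B l"
    and XZ: "\<And>i l. i < a \<Longrightarrow> l < c \<Longrightarrow> i \<notin> A l \<Longrightarrow> \<exists>j<b. j \<in> B l \<and> j \<notin> X i"
    and ZY: "\<And>j l. j < b \<Longrightarrow> l < c \<Longrightarrow> j \<in> B l \<Longrightarrow> \<exists>i<a. j \<notin> X i \<and> i \<notin> A l"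
    and YZ: "\<And>j l. j < b \<Longrightarrow> l < c \<Longrightarrow> j \<notin> B l \<Longrightarrow> \<exists>i<a. i \<in> A l \<and> j \<in> X i"
    and XX: "\<And>i i'. i < a \<Longrightarrow> i' < a \<Longrightarrow> i \<noteq> i' \<Longrightarrow>
      (\<exists>j<b. j \<in> X i \<and> j \<notin> X i') \<or> (\<exists>l<c. i \<notin> A l \<and> i' \<in> A l)"
    and YY: "\<And>j j'. j < b \<Longrightarrow> j' < b \<Longrightarrow> j \<noteq> j' \<Longrightarrow>
      (\<exists>i<a. j \<notin> X i \<and> j' \<in> X i) \<or> (\<exists>l<c. j \<notin> B l \<and> j' \<in> B l)"
    and ZZ: "\<And>l l'. l < c \<Longrightarrow> l' < c \<Longrightarrow> l \<noteq> l' \<Longrightarrow>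
      (\<exists>i<a. i \<in> A l \<and> i \<notin> A l') \<or> (\<exists>j<b. j \<in> B l \<and> j \<notin> B l')"
  shows "oriented_diameter (complete_tripartite a b c) \<le> 2"
proof (rule oriented_diameter_le_2[OF pair_graph_complete_tripartite _
      is_orientation_tripartite_orientation[of a b c X A B]])
  let ?D = "tripartite_orientation a b c X A B"
  note [simp] = in_parcs_tripartite_orientation
  have via: "(u, v) \<in> parcs ?D \<or> (\<exists>w. (u, w) \<in> parcs ?D \<and> (w, v) \<in> parcs ?D)"
    if "(u, v) \<notin> parcs ?D \<Longrightarrow> (\<exists>i. (u, (0, i)) \<in> parcs ?D \<and> ((0, i), v) \<in> parcs ?D) \<or>
        (\<exists>j. (u, (Suc 0, j)) \<in> parcs ?D \<and> ((Suc 0, j), v) \<in> parcs ?D) \<or>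
        (\<exists>l. (u, (2, l)) \<in> parcs ?D \<and> ((2, l), v) \<in> parcs ?D)" for u v
    using that by blast
  show "pverts (complete_tripartite a b c) \<noteq> {}"
    using \<open>0 < a\<close> by (auto simp: complete_tripartite_def Let_def)
  fix u v assume uv: "u \<in> pverts (complete_tripartite a b c)"
    "v \<in> pverts (complete_tripartite a b c)" "u \<noteq> v"
  show "(u, v) \<in> parcs ?D \<or> (\<exists>w. (u, w) \<in> parcs ?D \<and> (w, v) \<in> parcs ?D)"
    using uv(1,2)[THEN complete_tripartite_vertex_cases] uv(3)
  proof (elim disjE exE conjE)
    fix i i' assume "i < a" "u = (0, i)" "i' < a" "v = (0, i')"
    then show ?thesis using XX[of i i'] uv(3) by - (rule via, simp, blast)
  next
    \<comment> \<open>If (u, v) is not an arc, then (v, u) is, and its triangle returns from u to v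
      through the third part. Hence the hypothesis used is named after the reverse pair.\<close>
    fix i j assume "i < a" "u = (0, i)" "j < b" "v = (Suc 0, j)"
    then show ?thesis using YX[of i j] by - (rule via, auto)
  next
    fix i l assume "i < a" "u = (0, i)" "l < c" "v = (2, l)"
    then show ?thesis using ZX[of i l] by - (rule via, auto)
  next
    fix j i assume "j < b" "u = (Suc 0, j)" "i < a" "v = (0, i)"
    then show ?thesis using XY[of i j] by - (rule via, auto)
  next
    fix j j' assume "j < b" "u = (Suc 0, j)" "j' < b" "v = (Suc 0, j')"
    then show ?thesis using YY[of j j'] uv(3) by - (rule via, simp, blast)
  next
    fix j l assume "j < b" "u = (Suc 0, j)" "l < c" "v = (2, l)"
    then show ?thesis using ZY[of j l] by - (rule via, auto)
  next
    fix l i assume "l < c" "u = (2, l)" "i < a" "v = (0, i)"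
    then show ?thesis using XZ[of i l] by - (rule via, auto)
  next
    fix l j assume "l < c" "u = (2, l)" "j < b" "v = (Suc 0, j)"
    then show ?thesis using YZ[of j l] by - (rule via, auto)
  next
    fix l l' assume "l < c" "u = (2, l)" "l' < c" "v = (2, l')"
    then show ?thesis using ZZ[of l l'] uv(3) by - (rule via, simp, blast)
  qed
qed

section \<open>The orientation of K(3,p,q)\<close>

theorem theorem5p8:
  fixes p q :: nat
  assumes "p \<ge> 5"
    and "p + 3 \<le> q"
    and "q \<le> 3 + (p choose (p div 2))"
  shows "oriented_diameter (complete_tripartite 3 p q) = 2"
proof (rule antisym)
  have "((0, 0), (1, 0)) \<in> parcs (complete_tripartite 3 p q)"
    using assms by (auto simp: complete_tripartite_def)
  then show "oriented_diameter (complete_tripartite 3 p q) \<ge> 2"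
    by (rule oriented_diameter_ge_2[OF pair_graph_complete_tripartite])
next
  \<comment> \<open>\<open>m\<close> of the z's take their sets from the family. As p \<ge> 5,
    \<open>k\<close> is at least 2, so no member of the family is a singleton.\<close>
  define k m where "k = p div 2" and "m = q - 3"
  have k: "2 \<le> k" "2 * k \<le> p" and q: "q = m + 3" and m: "p \<le> m" "m \<le> p choose k"
    using assms by (auto simp: k_def m_def)
  then obtain f :: "nat \<Rightarrow> nat set" where inj: "inj_on f {..<m}"
    and sub: "\<And>j. j < m \<Longrightarrow> f j \<subseteq> {..<p}" and card: "\<And>j. j < m \<Longrightarrow> card (f j) = k"
    and sep: "\<And>y y'. y < p \<Longrightarrow> y' < p \<Longrightarrow> y \<noteq> y' \<Longrightarrow> \<exists>j<m. y \<in> f j \<and> y' \<notin> f j"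
    using separating_family[of k p m] by auto
  have fin: "finite (f j)" if "j < m" for j
    using sub[OF that] finite_subset by blast
  \<comment> \<open>A set of at most \<open>k\<close> elements can contain the \<open>k\<close>-set
    \<open>f j\<close> only by being equal to it.\<close>
  have f_diff: "\<exists>y<p. y \<in> f j \<and> y \<notin> S" if "j < m" "finite S" "card S \<le> k" "S \<noteq> f j" for j S
  proof -
    have "\<not> f j \<subseteq> S"
      using card_seteq[of S "f j"] that card by auto
    then show ?thesis
      using sub that by blast
  qed
  \<comment> \<open>Separate \<open>y\<close> from whichever of 0 and 1 differs from it.\<close>
  have hit: "\<exists>j<m. y \<in> f j" if "y < p" for y
    using sep[of y 0] sep[of y 1] that assms(1) by fastforce
  define X where "X i = (if i = 0 then UNIV else {i - 1})" for i :: nat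
  define A :: "nat \<Rightarrow> nat set" where
    "A l = (if l < m then {0} else if l = m then {0, 1} else if l = m + 1 then {0, 2} else {0, 1, 2})"
    for l
  define B where "B l = (if l < m then f l else if l = m + 2 then {} else {2})" for l
  have less3: "i = 0 \<or> i = 1 \<or> i = 2" if "i < 3" for i :: nat
    using that by auto
  have z: "l < m \<or> l = m \<or> l = m + 1 \<or> l = m + 2" if "l < q" for l
    using that q by auto
  show "oriented_diameter (complete_tripartite 3 p q) \<le> 2"
  proof (rule oriented_diameter_tripartite_le_2[where X = X and A = A and B = B])
    fix i j assume "i < 3" "j < p" "j \<in> X i"
    then show "\<exists>l<q. j \<notin> B l \<and> i \<in> A l"
      \<comment> \<open>The last z dominates every x and is dominated by every y, so it serves all
        arcs from x to y.\<close>
      using q by (intro exI[of _ "m + 2"]) (auto simp: A_def B_def)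
  next
    fix i j assume "i < 3" "j < p" "j \<notin> X i"
    moreover obtain l where "l < m" "j \<in> f l"
      using hit \<open>j < p\<close> by blast
    ultimately show "\<exists>l<q. i \<notin> A l \<and> j \<in> B l"
      \<comment> \<open>Here \<open>i\<close> is 1 or 2, since \<open>X 0\<close> contains
        everything, and such an x dominates every z of index below \<open>m\<close>.\<close>
      using q by (intro exI[of _ l]) (auto simp: A_def B_def X_def split: if_splits)
  next
    fix i l assume il: "i < 3" "l < q" "i \<in> A l"
    show "\<exists>j<p. j \<in> X i \<and> j \<notin> B l"
    proof (cases "l < m")
      case True
      then have "\<not> {..<p} \<subseteq> f l"
        using card_mono[OF fin, of l "{..<p}"] card k by auto
      then show ?thesis
        using True il by (auto simp: A_def B_def X_def)
    next
      case False
      then show ?thesis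
        \<comment> \<open>Truncated subtraction gives 0 for i = 0, which is harmless as
          \<open>X 0\<close> is everything; \<open>B l\<close> contains at most 2.\<close>
        using il assms(1) by (intro exI[of _ "i - 1"]) (auto simp: A_def B_def X_def split: if_splits)
    qed
  next
    fix i l assume il: "i < 3" "l < q" "i \<notin> A l"
    show "\<exists>j<p. j \<in> B l \<and> j \<notin> X i"
    proof (cases "l < m")
      case True
      then have "card {i - 1} \<noteq> card (f l)"
        using card[of l] k(1) by simp
      then have "{i - 1} \<noteq> f l"
        by metis
      then show ?thesis
        using True il f_diff[of l "{i - 1}"] k by (auto simp: A_def B_def X_def)
    next
      case False
      then show ?thesis
        using il less3[of i] z[of l] assms(1)
        \<comment> \<open>The vertex \<open>y\<^sub>2\<close> is dominated by neither
          \<open>x\<^sub>1\<close> nor \<open>x\<^sub>2\<close>.\<close>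
        by (intro exI[of _ 2]) (auto simp: A_def B_def X_def)
    qed
  next
    fix j l assume "j < p" "l < q" "j \<in> B l"
    then show "\<exists>i<3. j \<notin> X i \<and> i \<notin> A l"
      using z[of l]
      \<comment> \<open>For l = m only \<open>x\<^sub>2\<close> dominates the z, for l = m + 1 only
        \<open>x\<^sub>1\<close>; for l < m both do, and j = 0 rules out
        \<open>x\<^sub>1\<close>.\<close>
      by (intro exI[of _ "if l = m \<or> l < m \<and> j = 0 then 2 else 1"])
        (auto simp: A_def B_def X_def)
  next
    fix j l assume "j < p" "l < q" "j \<notin> B l"
    then show "\<exists>i<3. i \<in> A l \<and> j \<in> X i"
      by (intro exI[of _ 0]) (auto simp: A_def X_def)
  next
    fix i i' :: nat assume ii: "i < 3" "i' < 3" "i \<noteq> i'"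
    show "(\<exists>j<p. j \<in> X i \<and> j \<notin> X i') \<or> (\<exists>l<q. i \<notin> A l \<and> i' \<in> A l)"
    proof (cases "i' = 0")
      case True
      then show ?thesis
        using ii q m assms(1) by (intro disjI2 exI[of _ 0]) (auto simp: A_def)
    next
      case False
      then show ?thesis
        using ii assms(1)
        by (intro disjI1 exI[of _ "if i = 0 then 2 else i - 1"]) (auto simp: X_def)
    qed
  next
    fix j j' assume "j < p" "j' < p" "j \<noteq> j'"
    then obtain l where "l < m" "j' \<in> f l" "j \<notin> f l"
      using sep by metis
    then show "(\<exists>i<3. j \<notin> X i \<and> j' \<in> X i) \<or> (\<exists>l<q. j \<notin> B l \<and> j' \<in> B l)"
      using q by (intro disjI2 exI[of _ l]) (auto simp: B_def)
  next
    fix l l' assume ll: "l < q" "l' < q" "l \<noteq> l'"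
    show "(\<exists>i<3. i \<in> A l \<and> i \<notin> A l') \<or> (\<exists>j<p. j \<in> B l \<and> j \<notin> B l')"
    proof (cases "l < m")
      case True
      have "card {2} \<noteq> card (f l)"
        using True card[of l] k(1) by simp
      then have "{2} \<noteq> f l"
        by metis
      \<comment> \<open>Whether or not l' < m, \<open>B l'\<close> is thus small enough and
        different from \<open>f l\<close> for \<open>f_diff\<close> to apply.\<close>
      then have "finite (B l')" "card (B l') \<le> k" "B l' \<noteq> f l"
        using True ll fin card[of l'] card[of l] k inj
        by (auto simp: B_def inj_on_eq_iff)
      then show ?thesis
        using True f_diff[of l "B l'"] by (auto simp: B_def)
    next
      case False
      have "2 < p" using assms(1) by simp
      \<comment> \<open>Only against l' = m + 2, whose z dominates every x, is
        \<open>y\<^sub>2\<close> required; otherwise \<open>x\<^sub>1\<close> or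
        \<open>x\<^sub>2\<close> tells the two apart.\<close>
      have "2 \<in> A l \<and> 2 \<notin> A l' \<or> 1 \<in> A l \<and> 1 \<notin> A l' \<or> 2 \<in> B l \<and> 2 \<notin> B l'"
        using z[OF ll(1)] z[OF ll(2)] ll(3) False
        by (elim disjE) (simp_all add: A_def B_def)
      then show ?thesis
        using \<open>2 < p\<close> by (elim disjE) (force intro: exI[of _ 2] exI[of _ 1])+
    qed
  qed simp
qed

end
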